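(* Let $V$ be a finite set and let $A$ be a real symmetric matrix indexed by $V$. Then $A$ is a Robinsonian similarity matrix if and only if $A$ has no weighted asteroidal triple.
   Context: A triple $(x,y,z)$ of distinct elements of $V$ is called Robinson (for $A$) if $A_{xz}\le \min\{A_{xy},A_{yz}\}$. A linear order $\pi$ of $V$ is a Robinson ordering of $A$ if every triple $(x,y,z)$ with $x\prec_\pi y\prec_\pi z$ is Robinson; $A$ is a Robinsonian similarity matrix if it admits a Robinson ordering. For $z\in V$, a path avoiding $z$ in $A$ is a sequence $P=(v_0,v_1,\dots,v_k)$ ($k\ge 0$) of distinct elements of $V\setminus\{z\}$ such that for each $1\le i\le k$ the triple $(v_{i-1},z,v_i)$ is not Robinson, i.e. $A_{v_{i-1}v_i}>\min\{A_{v_{i-1}z},A_{v_iz}\}$. For distinct $x,y,z\in V$ write $x\overset{z}{\sim}y$ if there is a path from $x$ to $y$ avoiding $z$ in $A$. A set $\{x,y,z\}$ of three distinct elements of $V$ is a weighted asteroidal triple of $A$ if $x\overset{z}{\sim}y$, $y\overset{x}{\sim}z$ and $z\overset{y}{\sim}x$. *)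

theory Defs
  imports Complex_Main
begin

text \<open>
  A matrix indexed by a set \<open>V\<close> is a function \<open>A :: 'a \<Rightarrow> 'a \<Rightarrow> real\<close> of which only the entries at
  arguments in \<open>V\<close> matter.
\<close>

definition symmetric_matrix_on :: "'a set \<Rightarrow> ('a \<Rightarrow> 'a \<Rightarrow> real) \<Rightarrow> bool" where
  "symmetric_matrix_on V A \<longleftrightarrow> (\<forall>x\<in>V. \<forall>y\<in>V. A x y = A y x)"

text \<open>
  Being Robinson is a property of triples of distinct elements of \<open>V\<close>. Distinctness and membership
  in \<open>V\<close> are not part of the predicate; they hold wherever it is used below.
\<close>

definition robinson_triple :: "('a \<Rightarrow> 'a \<Rightarrow> real) \<Rightarrow> 'a \<Rightarrow> 'a \<Rightarrow> 'a \<Rightarrow> bool" where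
  "robinson_triple A x y z \<longleftrightarrow> A x z \<le> min (A x y) (A y z)"

text \<open>
  The relation \<open>r\<close> of \<^const>\<open>linear_order_on\<close> is reflexive; the strict order consists of the pairs
  of distinct elements in \<open>r\<close>.
\<close>

definition robinson_ordering :: "'a set \<Rightarrow> ('a \<Rightarrow> 'a \<Rightarrow> real) \<Rightarrow> 'a rel \<Rightarrow> bool" where
  "robinson_ordering V A r \<longleftrightarrow>
     linear_order_on V r \<and>
     (\<forall>x\<in>V. \<forall>y\<in>V. \<forall>z\<in>V.
        (x, y) \<in> r \<and> x \<noteq> y \<and> (y, z) \<in> r \<and> y \<noteq> z \<longrightarrow> robinson_triple A x y z)"

definition robinsonian_similarity :: "'a set \<Rightarrow> ('a \<Rightarrow> 'a \<Rightarrow> real) \<Rightarrow> bool" where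
  "robinsonian_similarity V A \<longleftrightarrow> (\<exists>r. robinson_ordering V A r)"

definition path_avoiding :: "'a set \<Rightarrow> ('a \<Rightarrow> 'a \<Rightarrow> real) \<Rightarrow> 'a \<Rightarrow> 'a list \<Rightarrow> bool" where
  "path_avoiding V A z P \<longleftrightarrow>
     P \<noteq> [] \<and> distinct P \<and> set P \<subseteq> V - {z} \<and>
     successively (\<lambda>u v. \<not> robinson_triple A u z v) P"

definition connected_avoiding :: "'a set \<Rightarrow> ('a \<Rightarrow> 'a \<Rightarrow> real) \<Rightarrow> 'a \<Rightarrow> 'a \<Rightarrow> 'a \<Rightarrow> bool" where
  "connected_avoiding V A z x y \<longleftrightarrow> (\<exists>P. path_avoiding V A z P \<and> hd P = x \<and> last P = y)"

definition weighted_asteroidal_triple :: "'a set \<Rightarrow> ('a \<Rightarrow> 'a \<Rightarrow> real) \<Rightarrow> 'a set \<Rightarrow> bool" where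
  "weighted_asteroidal_triple V A T \<longleftrightarrow>
     (\<exists>x\<in>V. \<exists>y\<in>V. \<exists>z\<in>V.
        T = {x, y, z} \<and> x \<noteq> y \<and> y \<noteq> z \<and> x \<noteq> z \<and>
        connected_avoiding V A z x y \<and>
        connected_avoiding V A x y z \<and>
        connected_avoiding V A y z x)"

end

theory Submission
  imports Defs
begin

text \<open>
  The graph on \<open>V - {z}\<close> whose edges are the pairs \<open>u, v\<close> with \<open>(u, z, v)\<close> not Robinson has
  as its components the sets that must lie on one side of \<open>z\<close>. The engine of the proof is that
  a path from \<open>x\<close> to \<open>a\<close> avoiding \<open>y\<close> also avoids every \<open>z\<close> that is not connected to \<open>a\<close> in the
  graph of \<open>y\<close>.

  Sufficiency is by induction on \<open>card V\<close>. If \<open>V\<close> has a proper subset \<open>M\<close> of at least two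
  elements that the outside cannot distinguish, and whose elements are at least as similar to each
  other as to the outside, then orderings of \<open>M\<close> and of \<open>V\<close> with \<open>M\<close> contracted to a point are
  combined. Otherwise some \<open>a\<close> has a connected graph, and we start from the weak order that puts
  \<open>a\<close> before everything else. It is refined as long as possible: if \<open>x, y\<close> are tied, both are
  before \<open>w\<close>, and \<open>y\<close> is connected to \<open>w\<close> avoiding \<open>x\<close>, then \<open>x\<close> must go before \<open>y\<close>
  (and dually). The tie classes of a maximal refinement are indistinguishable from outside,
  hence singletons.
\<close>

section \<open>Connection avoiding a point\<close>

definition avoiding_edge :: "'a set \<Rightarrow> ('a \<Rightarrow> 'a \<Rightarrow> real) \<Rightarrow> 'a \<Rightarrow> 'a \<Rightarrow> 'a \<Rightarrow> bool" where
  "avoiding_edge V A z u v \<longleftrightarrow> u \<in> V - {z} \<and> v \<in> V - {z} \<and> \<not> robinson_triple A u z v"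

lemma path_avoiding_imp_rtranclp:
  "path_avoiding V A z P \<Longrightarrow> (avoiding_edge V A z)\<^sup>*\<^sup>* (hd P) (last P)"
proof (induction P)
  case Nil
  then show ?case by (simp add: path_avoiding_def)
next
  case (Cons u P)
  show ?case
  proof (cases P)
    case Nil
    then show ?thesis by simp
  next
    case (Cons v Q)
    then have "path_avoiding V A z P" "avoiding_edge V A z u v"
      using Cons.prems by (auto simp: path_avoiding_def avoiding_edge_def)
    then show ?thesis
      using Cons.IH Cons by (auto intro: converse_rtranclp_into_rtranclp)
  qed
qed

text \<open>Walks suffice: if the next vertex already occurs on the path, cutting the path back
  there keeps it distinct. Membership of \<open>x\<close> is stated separately because the reflexive
  closure relates every point to itself.\<close>

lemma connected_avoiding_iff:
  "connected_avoiding V A z x y \<longleftrightarrow> x \<in> V - {z} \<and> (avoiding_edge V A z)\<^sup>*\<^sup>* x y"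
proof
  assume "connected_avoiding V A z x y"
  then obtain P where P: "path_avoiding V A z P" "hd P = x" "last P = y"
    unfolding connected_avoiding_def by blast
  have "x \<in> V - {z}"
    using P hd_in_set[of P] by (auto simp: path_avoiding_def)
  then show "x \<in> V - {z} \<and> (avoiding_edge V A z)\<^sup>*\<^sup>* x y"
    using path_avoiding_imp_rtranclp[OF P(1)] P by simp
next
  assume *: "x \<in> V - {z} \<and> (avoiding_edge V A z)\<^sup>*\<^sup>* x y"
  then have "(avoiding_edge V A z)\<^sup>*\<^sup>* x y" by simp
  then show "connected_avoiding V A z x y"
  proof (induction rule: rtranclp_induct)
    case base
    have "path_avoiding V A z [x]" using * by (auto simp: path_avoiding_def)
    then show ?case unfolding connected_avoiding_def by (metis last.simps list.sel(1))
  next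
    case (step v w)
    then obtain P where P: "path_avoiding V A z P" "hd P = x" "last P = v"
      unfolding connected_avoiding_def by blast
    show ?case
    proof (cases "w \<in> set P")
      case True
      then obtain Q S where "P = Q @ w # S" by (meson split_list)
      then have "path_avoiding V A z (Q @ [w])" "hd (Q @ [w]) = x"
        using P by (auto simp: path_avoiding_def successively_append_iff hd_append)
      then show ?thesis unfolding connected_avoiding_def by (metis last_snoc)
    next
      case False
      then have "path_avoiding V A z (P @ [w])"
        using P step by (auto simp: path_avoiding_def successively_append_iff avoiding_edge_def)
      moreover have "hd (P @ [w]) = x"
        using P by (auto simp: path_avoiding_def)
      ultimately show ?thesis unfolding connected_avoiding_def by (metis last_snoc)
    qed
  qed
qed

lemma connected_avoiding_mono:
  "connected_avoiding W A z x y \<Longrightarrow> W \<subseteq> V \<Longrightarrow> connected_avoiding V A z x y"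
  unfolding connected_avoiding_def path_avoiding_def by blast

lemma connected_avoiding_trans:
  "connected_avoiding V A z x y \<Longrightarrow> connected_avoiding V A z y w \<Longrightarrow> connected_avoiding V A z x w"
  by (auto simp: connected_avoiding_iff)

lemma connected_avoiding_refl: "x \<in> V \<Longrightarrow> x \<noteq> z \<Longrightarrow> connected_avoiding V A z x x"
  by (auto simp: connected_avoiding_iff)

lemma connected_avoiding_in:
  assumes "connected_avoiding V A z x y"
  shows "x \<in> V" "y \<in> V" "x \<noteq> z" "y \<noteq> z"
  using assms by (auto simp: connected_avoiding_iff avoiding_edge_def elim: rtranclp.cases)

lemma avoiding_edge_imp_connected: "avoiding_edge V A z x y \<Longrightarrow> connected_avoiding V A z x y"
  by (auto simp: connected_avoiding_iff avoiding_edge_def)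

lemma robinson_triple_if_not_connected:
  assumes "\<not> connected_avoiding V A y x z" "x \<in> V" "z \<in> V" "x \<noteq> y" "y \<noteq> z"
  shows "A x z \<le> A x y" "A x z \<le> A y z"
  using assms avoiding_edge_imp_connected[of V A y x z]
  by (auto simp: avoiding_edge_def robinson_triple_def)

text \<open>Distinctness and membership in \<open>V\<close> are implied by the three
  connections.\<close>

definition no_wat :: "'a set \<Rightarrow> ('a \<Rightarrow> 'a \<Rightarrow> real) \<Rightarrow> bool" where
  "no_wat V A \<longleftrightarrow> (\<forall>x y z. \<not> (connected_avoiding V A z x y \<and> connected_avoiding V A x y z \<and>
     connected_avoiding V A y z x))"

lemma no_wat_iff: "no_wat V A \<longleftrightarrow> \<not> (\<exists>T. weighted_asteroidal_triple V A T)"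
  unfolding no_wat_def weighted_asteroidal_triple_def
  by (metis connected_avoiding_in)

lemma no_wat_subset: "no_wat V A \<Longrightarrow> W \<subseteq> V \<Longrightarrow> no_wat W A"
  unfolding no_wat_def by (meson connected_avoiding_mono)

text \<open>Homogeneity alone would not do for the contraction: the inequality is what allows a module to
  be an interval of a Robinson ordering.\<close>

definition tight_module :: "'a set \<Rightarrow> ('a \<Rightarrow> 'a \<Rightarrow> real) \<Rightarrow> 'a set \<Rightarrow> bool" where
  "tight_module V A M \<longleftrightarrow> M \<subset> V \<and> (\<exists>x\<in>M. \<exists>y\<in>M. x \<noteq> y) \<and>
     (\<forall>x\<in>M. \<forall>y\<in>M. \<forall>z\<in>V - M. x \<noteq> y \<longrightarrow> A x z = A y z \<and> A x z \<le> A x y)"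

definition strict_robinson :: "'a set \<Rightarrow> ('a \<Rightarrow> 'a \<Rightarrow> real) \<Rightarrow> ('a \<Rightarrow> 'a \<Rightarrow> bool) \<Rightarrow> bool" where
  "strict_robinson V A R \<longleftrightarrow>
     (\<forall>x\<in>V. \<not> R x x) \<and>
     (\<forall>x\<in>V. \<forall>y\<in>V. \<forall>z\<in>V. R x y \<longrightarrow> R y z \<longrightarrow> R x z) \<and>
     (\<forall>x\<in>V. \<forall>y\<in>V. x \<noteq> y \<longrightarrow> R x y \<or> R y x) \<and>
     (\<forall>x\<in>V. \<forall>y\<in>V. \<forall>z\<in>V. R x y \<longrightarrow> R y z \<longrightarrow> robinson_triple A x y z)"

lemma robinsonian_similarity_if_strict_robinson:
  assumes "strict_robinson V A R"
  shows "robinsonian_similarity V A"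
proof -
  let ?r = "{(x, y). x \<in> V \<and> y \<in> V \<and> (x = y \<or> R x y)}"
  have R: "\<And>x. x \<in> V \<Longrightarrow> \<not> R x x"
    "\<And>x y z. x \<in> V \<Longrightarrow> y \<in> V \<Longrightarrow> z \<in> V \<Longrightarrow> R x y \<Longrightarrow> R y z \<Longrightarrow> R x z"
    "\<And>x y. x \<in> V \<Longrightarrow> y \<in> V \<Longrightarrow> x \<noteq> y \<Longrightarrow> R x y \<or> R y x"
    using assms unfolding strict_robinson_def by blast+
  have "refl_on V ?r" by (auto simp: refl_on_def)
  moreover have "trans ?r" unfolding trans_def using R(2) by blast
  moreover have "antisym ?r" unfolding antisym_def using R(1,2) by blast
  moreover have "total_on V ?r" unfolding total_on_def using R(3) by blast
  moreover have "?r \<subseteq> V \<times> V" by auto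
  ultimately have "linear_order_on V ?r"
    unfolding linear_order_on_def partial_order_on_def preorder_on_def by blast
  moreover have "robinson_triple A x y z"
    if "(x, y) \<in> ?r" "x \<noteq> y" "(y, z) \<in> ?r" "y \<noteq> z" for x y z
    using that assms unfolding strict_robinson_def by blast
  ultimately have "robinson_ordering V A ?r" unfolding robinson_ordering_def by blast
  then show ?thesis unfolding robinsonian_similarity_def by blast
qed

locale similarity_matrix =
  fixes V :: "'a set" and A :: "'a \<Rightarrow> 'a \<Rightarrow> real"
  assumes fin: "finite V" and sym_mat: "symmetric_matrix_on V A"
begin

abbreviation conn :: "'a \<Rightarrow> 'a \<Rightarrow> 'a \<Rightarrow> bool" where
  "conn \<equiv> connected_avoiding V A"

lemma A_sym: "x \<in> V \<Longrightarrow> y \<in> V \<Longrightarrow> A x y = A y x"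
  using sym_mat by (auto simp: symmetric_matrix_on_def)

lemma conn_sym:
  assumes "conn z x y" "z \<in> V"
  shows "conn z y x"
proof -
  have "symp (avoiding_edge V A z)"
    unfolding symp_def avoiding_edge_def robinson_triple_def
    using A_sym assms(2) by (auto simp: min.commute)
  then have "symp (avoiding_edge V A z)\<^sup>*\<^sup>*" by (rule symp_rtranclp)
  moreover have "(avoiding_edge V A z)\<^sup>*\<^sup>* x y"
    using assms(1) by (simp add: connected_avoiding_iff)
  ultimately have "(avoiding_edge V A z)\<^sup>*\<^sup>* y x" by (rule sympD)
  then show ?thesis
    using connected_avoiding_in(2,4)[OF assms(1)] by (simp add: connected_avoiding_iff)
qed

lemma conn_cong: "conn z x y \<Longrightarrow> z \<in> V \<Longrightarrow> conn z w x \<longleftrightarrow> conn z w y"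
  using conn_sym[of z x y] connected_avoiding_trans[of V A z w] by blast

text \<open>If an edge \<open>u, v\<close> of the graph of \<open>y\<close> fails to avoid \<open>z\<close>, then \<open>z\<close> itself is adjacent to
  \<open>u\<close> or \<open>v\<close> in the graph of \<open>y\<close>.\<close>

lemma conn_exchange:
  assumes "conn y x a" "\<not> conn y z a" "z \<in> V" "z \<noteq> y" "y \<in> V"
  shows "conn z x a"
proof -
  have "(avoiding_edge V A y)\<^sup>*\<^sup>* x a" using assms by (simp add: connected_avoiding_iff)
  then show ?thesis
  proof (induction rule: converse_rtranclp_induct)
    case base
    then show ?case
      using assms connected_avoiding_in[of V A y x a] connected_avoiding_refl by metis
  next
    case (step u v)
    have uv: "conn y u v" using step(1) by (rule avoiding_edge_imp_connected)
    have va: "conn y v a"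
      using step uv connected_avoiding_in(2,4)[OF uv] by (simp add: connected_avoiding_iff)
    have ua: "conn y u a" using uv va connected_avoiding_trans by metis
    have ne: "u \<noteq> z" "v \<noteq> z" using ua va assms by auto
    have in_V: "u \<in> V" "v \<in> V" "u \<noteq> y" "v \<noteq> y" using uv connected_avoiding_in by metis+
    have nc: "\<not> conn y u z" "\<not> conn y z v"
      using ua va assms connected_avoiding_trans conn_sym by metis+
    have "conn z u v"
    proof (rule ccontr)
      assume "\<not> conn z u v"
      \<comment> \<open>The chains \<open>A u v \<le> A u z \<le> A u y\<close> and
        \<open>A u v \<le> A z v \<le> A y v\<close> contradict the edge from \<open>u\<close> to
        \<open>v\<close>.\<close>
      note robinson_triple_if_not_connected[OF this in_V(1,2) ne(1) ne(2)[symmetric]]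
      moreover note robinson_triple_if_not_connected[OF nc(1) in_V(1) assms(3) in_V(3) assms(4)[symmetric]]
      moreover note robinson_triple_if_not_connected[OF nc(2) assms(3) in_V(2) assms(4) in_V(4)[symmetric]]
      moreover have "\<not> (A u v \<le> A u y \<and> A u v \<le> A y v)"
        using step(1) by (auto simp: avoiding_edge_def robinson_triple_def)
      ultimately show False by linarith
    qed
    then show ?case using step.IH connected_avoiding_trans by metis
  qed
qed

section \<open>Necessity: Robinson orderings exclude asteroidal triples\<close>

text \<open>If an edge crossed \<open>z\<close>, then \<open>z\<close> would lie between its ends
  and the triple would be Robinson. Hence no path avoiding \<open>z\<close> changes sides.\<close>

lemma conn_same_side:
  assumes "robinson_ordering V A r" "conn z x y" "z \<in> V"
  shows "(x, z) \<in> r \<longleftrightarrow> (y, z) \<in> r"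
proof -
  have lin: "linear_order_on V r" and
    rob: "\<And>x y z. \<lbrakk>x \<in> V; y \<in> V; z \<in> V; (x, y) \<in> r; x \<noteq> y; (y, z) \<in> r; y \<noteq> z\<rbrakk> \<Longrightarrow> robinson_triple A x y z"
    using assms(1) unfolding robinson_ordering_def by blast+
  have tot: "(x, y) \<in> r \<or> (y, x) \<in> r" if "x \<in> V" "y \<in> V" "x \<noteq> y" for x y
    using lin that unfolding linear_order_on_def total_on_def by blast
  have "(avoiding_edge V A z)\<^sup>*\<^sup>* x y" using assms(2) by (simp add: connected_avoiding_iff)
  then show ?thesis
  proof (induction rule: rtranclp_induct)
    case (step u v)
    then have uv: "u \<in> V" "v \<in> V" "u \<noteq> z" "v \<noteq> z" "\<not> robinson_triple A u z v"
      by (auto simp: avoiding_edge_def)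
    then have "\<not> robinson_triple A v z u"
      using A_sym assms(3) by (auto simp: robinson_triple_def)
    then have "(u, z) \<in> r \<longleftrightarrow> (v, z) \<in> r"
      using uv assms(3) rob tot by metis
    with step.IH show ?case by simp
  qed simp
qed

text \<open>The middle one of three points in a Robinson ordering separates the other two, so no
  path between these avoids it.\<close>

lemma robinsonian_imp_no_wat:
  assumes "robinsonian_similarity V A"
  shows "no_wat V A"
  unfolding no_wat_def
proof (intro allI notI)
  fix x y z
  assume c: "conn z x y \<and> conn x y z \<and> conn y z x"
  obtain r where r: "robinson_ordering V A r"
    using assms unfolding robinsonian_similarity_def by blast
  have V: "x \<in> V" "y \<in> V" "z \<in> V" and ne: "x \<noteq> y" "y \<noteq> z" "x \<noteq> z"
    using c connected_avoiding_in by metis+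
  have lin: "linear_order_on V r" using r unfolding robinson_ordering_def by blast
  have tot: "(u, v) \<in> r \<or> (v, u) \<in> r" if "u \<in> V" "v \<in> V" "u \<noteq> v" for u v
    using lin that unfolding linear_order_on_def total_on_def by blast
  have anti: "\<not> ((u, v) \<in> r \<and> (v, u) \<in> r)" if "u \<noteq> v" for u v
    using lin that unfolding linear_order_on_def partial_order_on_def antisym_def by blast
  have "(x, z) \<in> r \<longleftrightarrow> (y, z) \<in> r" "(y, x) \<in> r \<longleftrightarrow> (z, x) \<in> r" "(z, y) \<in> r \<longleftrightarrow> (x, y) \<in> r"
    using conn_same_side[OF r] c V by blast+
  then show False using tot anti V ne by metis
qed

section \<open>A point with a connected graph\<close>

definition component :: "'a \<Rightarrow> 'a \<Rightarrow> 'a set" where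
  "component a u = {x. conn a x u}"

lemma finite_component: "finite (component a u)"
  using fin by (rule rev_finite_subset) (auto simp: component_def dest: connected_avoiding_in)

text \<open>By \<open>conn_exchange\<close> every path to \<open>u\<close> avoiding \<open>a\<close>
  also connects its start to \<open>u\<close> around \<open>v\<close>. The point \<open>a\<close>
  itself is a new member.\<close>

lemma component_grows:
  assumes "a \<in> V" "v \<in> V" "conn v a u" "conn a u u" "\<not> conn a v u" "v \<noteq> a"
  shows "card (component a u) < card (component v u)"
proof (rule psubset_card_mono[OF finite_component], rule psubsetI)
  show "component a u \<subseteq> component v u"
    using conn_exchange[OF _ assms(5,2,6,1)] by (auto simp: component_def)
  show "component a u \<noteq> component v u"
    using assms(3) connected_avoiding_in(3)[of V A a a u] by (auto simp: component_def)
qed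

text \<open>Extremal choice: \<open>a\<close> and \<open>u0\<close> are taken so that the component
  \<open>?K\<close> has maximal cardinality over all graphs. If \<open>?K\<close> missed a point
  other than \<open>a\<close>, the complement of \<open>?K\<close> would be a tight module.\<close>

lemma exists_connected_point:
  assumes "\<not> (\<exists>M. tight_module V A M)" "V \<noteq> {}"
  obtains a where "a \<in> V" "\<And>x y. x \<in> V - {a} \<Longrightarrow> y \<in> V - {a} \<Longrightarrow> conn a x y"
proof (cases "\<exists>c. V = {c}")
  case True
  then show thesis using that by blast
next
  case False
  then obtain p q where pq: "p \<in> V" "q \<in> V" "p \<noteq> q" using assms(2) by blast
  let ?S = "{(a, u). a \<in> V \<and> u \<in> V \<and> a \<noteq> u}"
  let ?f = "\<lambda>(a, u). card (component a u)"
  have "finite ?S" by (rule finite_subset[of _ "V \<times> V"]) (use fin in auto)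
  moreover have "?S \<noteq> {}" using pq by auto
  ultimately obtain s where s: "s \<in> ?S" "Max (?f ` ?S) = ?f s"
    by (rule obtains_MAX[where f = ?f])
  have s_max: "?f t \<le> ?f s" if "t \<in> ?S" for t
    using Max_ge[OF finite_imageI[OF \<open>finite ?S\<close>] imageI[OF that], of ?f] s(2) by simp
  obtain a u0 where s_eq: "s = (a, u0)" by (cases s)
  have a: "a \<in> V" "u0 \<in> V" "a \<noteq> u0" using s s_eq by auto
  have max: "card (component b v) \<le> card (component a u0)" if "b \<in> V" "v \<in> V" "b \<noteq> v" for b v
    using s_max[of "(b, v)"] that s_eq by simp
  let ?K = "component a u0"
  have comp_eq: "component a u = ?K" if "u \<in> ?K" for u
    using that conn_cong[OF _ a(1)] by (auto simp: component_def)
  have K: "u \<in> V" "u \<noteq> a" if "u \<in> ?K" for u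
    using that connected_avoiding_in(1,3) unfolding component_def by fast+
  have u0: "u0 \<in> ?K" using a connected_avoiding_refl[of u0 V a A] by (auto simp: component_def)
  show thesis
  proof (cases "V - {a} \<subseteq> ?K")
    case True
    have "conn a x y" if "x \<in> V - {a}" "y \<in> V - {a}" for x y
      using that True comp_eq[of y] by (auto simp: component_def)
    then show thesis using that a by blast
  next
    case False
    \<comment> \<open>Otherwise the component of \<open>u\<close> around \<open>v\<close> would be
      larger than \<open>?K\<close>.\<close>
    have nc: "\<not> conn v a u" if "v \<in> V" "v \<notin> ?K" "u \<in> ?K" for u v
    proof
      assume c: "conn v a u"
      have "\<not> conn a v u" using that comp_eq[of u] by (auto simp: component_def)
      then have "card (component a u) < card (component v u)"
        using component_grows[of a v u] a c that K[of u] connected_avoiding_in(3)[OF c]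
          connected_avoiding_refl[of u V a A] by blast
      then show False
        using max[of v u] comp_eq[of u] that K[of u] by auto
    qed
    have eqs: "A a u = A u v" "A a u \<le> A a v" if "v \<in> V" "v \<notin> ?K" "v \<noteq> a" "u \<in> ?K" for u v
    proof -
      have "\<not> conn a u v"
        using that comp_eq[of u] conn_sym[of a u v] a(1) by (auto simp: component_def)
      note robinson_triple_if_not_connected[OF this]
      moreover note robinson_triple_if_not_connected[OF nc[OF that(1,2,4)]]
      ultimately show "A a u = A u v" "A a u \<le> A a v"
        using that a K[of u] A_sym[of a u] A_sym[of u v] by fastforce+
    qed
    have inner: "A u v \<le> A v w"
      if "v \<in> V" "v \<notin> ?K" "w \<in> V" "w \<notin> ?K" "u \<in> ?K" "v \<noteq> w" "v \<noteq> a" "w \<noteq> a" for u v w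
    proof (rule ccontr)
      assume less: "\<not> A u v \<le> A v w"
      \<comment> \<open>Here \<open>A a v \<ge> A a u = A u v > A v w\<close>, so both pairs are
        edges avoiding \<open>w\<close>. Together they join \<open>a\<close> to \<open>u\<close>
        around \<open>w\<close>, against \<open>nc\<close>.\<close>
      have "conn w v u" "conn w a v"
        using less that a K[of u] eqs[of v u] A_sym[of u v] A_sym[of a v] A_sym[of v w]
        by (auto intro!: avoiding_edge_imp_connected simp: avoiding_edge_def robinson_triple_def)
      then have "conn w a u"
        using connected_avoiding_trans[of V A w a v u] by blast
      then show False using nc that by blast
    qed
    have "A x z = A y z \<and> A x z \<le> A x y"
      if "x \<in> V - ?K" "y \<in> V - ?K" "z \<in> ?K" "x \<noteq> y" for x y z
    proof (cases "x = a")
      case True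
      then show ?thesis using eqs[of y z] that K[of z] A_sym[of y z] by auto
    next
      case xa: False
      show ?thesis
      proof (cases "y = a")
        case True
        then show ?thesis using eqs[of x z] xa that K[of z] a A_sym[of x z] A_sym[of x a] by auto
      next
        case False
        then show ?thesis
          using eqs[of x z] eqs[of y z] inner[of x y z] xa that K[of z] A_sym[of x z] A_sym[of y z]
          by auto
      qed
    qed
    moreover have "V - ?K \<subset> V" "a \<in> V - ?K" "V - (V - ?K) \<subseteq> ?K"
      using u0 a K by auto
    moreover obtain v where "v \<in> V - ?K" "v \<noteq> a" using False by auto
    ultimately have "tight_module V A (V - ?K)"
      unfolding tight_module_def by (metis subsetD)
    then show thesis using assms(1) by blast
  qed
qed

end

section \<open>Refining weak orders\<close>

text \<open>The last two assumptions are the invariants that keep refinement possible: \<open>tied\<close> makes the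
  refined relation asymmetric, and \<open>tied_pairs\<close> makes it satisfy \<open>between\<close>.\<close>

locale admissible_order = similarity_matrix +
  fixes R :: "'a \<Rightarrow> 'a \<Rightarrow> bool"
  assumes no_wat: "no_wat V A"
    and R_in: "R x y \<Longrightarrow> x \<in> V" "R x y \<Longrightarrow> y \<in> V"
    and asym: "R x y \<Longrightarrow> \<not> R y x"
    and negtrans: "R x y \<Longrightarrow> z \<in> V \<Longrightarrow> R x z \<or> R z y"
    and between: "R x y \<Longrightarrow> R y z \<Longrightarrow> \<not> conn y x z"
    and tied: "x \<in> V \<Longrightarrow> y \<in> V \<Longrightarrow> \<not> R x y \<Longrightarrow> \<not> R y x \<Longrightarrow> R x z \<and> R y z \<or> R z x \<and> R z y \<Longrightarrow>
      \<not> (conn x y z \<and> conn y x z)"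
    and tied_pairs: "x \<in> V \<Longrightarrow> y \<in> V \<Longrightarrow> \<not> R x y \<Longrightarrow> \<not> R y x \<Longrightarrow>
      u \<in> V \<Longrightarrow> v \<in> V \<Longrightarrow> \<not> R u v \<Longrightarrow> \<not> R v u \<Longrightarrow> R x u \<Longrightarrow> conn u x y \<or> conn x u v"
begin

lemma trans: "R x y \<Longrightarrow> R y z \<Longrightarrow> R x z"
  using R_in asym negtrans by meson

lemma wat: "conn z x y \<Longrightarrow> conn x y z \<Longrightarrow> conn y x z \<Longrightarrow> False"
  using no_wat conn_sym[of y x z] connected_avoiding_in(1)[of V A x y z] unfolding no_wat_def by blast

lemma tied_before:
  "\<not> R x y \<Longrightarrow> \<not> R y x \<Longrightarrow> R x z \<Longrightarrow> R y z \<Longrightarrow> conn x y z \<Longrightarrow> \<not> conn y x z"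
  using tied[of x y z] R_in[of x z] R_in[of y z] by blast

text \<open>The invariants are self-dual (\<open>tied_pairs\<close> swaps its two pairs), so only
  refinement from above need be studied. Refinement from below is refinement of the
  converse.\<close>

lemma admissible_converse: "admissible_order V A (\<lambda>x y. R y x)"
proof
  show "no_wat V A" by (rule no_wat)
next
  fix x y z
  show "R y x \<Longrightarrow> x \<in> V" "R y x \<Longrightarrow> y \<in> V" by (auto dest: R_in)
  show "R y x \<Longrightarrow> \<not> R x y" by (rule asym)
  show "R y x \<Longrightarrow> z \<in> V \<Longrightarrow> R z x \<or> R y z" using negtrans by blast
  show "R y x \<Longrightarrow> R z y \<Longrightarrow> \<not> conn y x z" using between conn_sym R_in by metis
next
  fix x y z
  assume "x \<in> V" "y \<in> V" "\<not> R y x" "\<not> R x y" "R z x \<and> R z y \<or> R x z \<and> R y z"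
  then show "\<not> (conn x y z \<and> conn y x z)" using tied by blast
next
  fix x y u v
  assume "x \<in> V" "y \<in> V" "\<not> R y x" "\<not> R x y" "u \<in> V" "v \<in> V" "\<not> R v u" "\<not> R u v" "R u x"
  then show "conn u x y \<or> conn x u v" using tied_pairs[of u v x y] by blast
qed

text \<open>The new pairs are forced: \<open>y\<close> must lie on the side of \<open>x\<close> on
  which \<open>w\<close> lies. All ties below the pivot \<open>w\<close> are split simultaneously,
  as splitting a single pair would in general destroy negative transitivity.\<close>

definition refine :: "'a \<Rightarrow> 'a \<Rightarrow> 'a \<Rightarrow> bool" where
  "refine w x y \<longleftrightarrow> R x y \<or> \<not> R x y \<and> \<not> R y x \<and> R x w \<and> R y w \<and> conn x y w"

text \<open>The delicate instance of \<open>between\<close> after refinement: \<open>x\<close> and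
  \<open>y\<close> were split by \<open>w\<close>, while \<open>y\<close> was already before
  \<open>z\<close>. A counterexample forces \<open>z\<close> and \<open>w\<close> to be tied, and
  then \<open>tied_pairs\<close> produces a configuration forbidden by \<open>tied\<close>.\<close>

lemma split_between:
  assumes "\<not> R x y" "\<not> R y x" "R x w" "R y w" "conn x y w" "R y z"
  shows "\<not> conn y x z"
proof
  assume c: "conn y x z"
  have V: "x \<in> V" "y \<in> V" "z \<in> V" "w \<in> V" using assms R_in by blast+
  have xz: "R x z" using negtrans[OF assms(6) V(1)] assms(2) by blast
  have n1: "\<not> conn x y z" "\<not> conn y x w"
    using tied[OF V(1,2) assms(1,2)] xz assms(3-6) c by blast+
  have zw: "\<not> conn x z w" using n1(1) assms(5) conn_sym V connected_avoiding_trans by metis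
  have wz: "\<not> conn y w z" using n1(2) c conn_sym V connected_avoiding_trans by metis
  have ne: "z \<noteq> x" "w \<noteq> y" using xz assms(4) asym by blast+
  have e: "conn w x z" "conn z y w"
    using conn_exchange[OF c wz V(4) ne(2) V(2)] conn_exchange[OF assms(5) zw V(3) ne(1) V(1)] .
  have "\<not> R z w" using between[OF assms(6)] e(2) by blast
  moreover have "\<not> R w z" using between[OF assms(3)] e(1) by blast
  \<comment> \<open>The second alternatives are excluded by \<open>zw\<close> and \<open>wz\<close>,
    so \<open>x\<close> and \<open>y\<close> are connected around both \<open>z\<close> and
    \<open>w\<close>. Prolonging by \<open>e\<close> connects \<open>z\<close> and \<open>w\<close>
    to \<open>x\<close> around each other.\<close>
  ultimately have "conn z x y \<or> conn x z w" "conn w x y \<or> conn y w z"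
    using tied_pairs[of x y z w] tied_pairs[of x y w z] tied_pairs[of y x w z] V xz assms(1-4)
      conn_sym by blast+
  then have "conn z x w" "conn w z x"
    using zw wz e V conn_sym connected_avoiding_trans by metis+
  then show False
    using tied[of z w x] V \<open>\<not> R z w\<close> \<open>\<not> R w z\<close> xz assms(3) conn_sym by blast
qed

text \<open>In the new case \<open>x\<close>, \<open>y\<close>, \<open>z\<close> are tied below
  \<open>w\<close>. If \<open>z\<close> is not connected to \<open>w\<close> around
  \<open>x\<close>, then \<open>conn_exchange\<close> connects \<open>y\<close> to \<open>w\<close>
  around \<open>z\<close>.\<close>

lemma refine_negtrans:
  assumes "refine w x y" "z \<in> V"
  shows "refine w x z \<or> refine w z y"
proof (cases "R x y \<or> R x z \<or> R z y")
  case True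
  then show ?thesis using assms negtrans[of x y z] unfolding refine_def by blast
next
  case False
  then have xy: "\<not> R x y" "\<not> R y x" "R x w" "R y w" "conn x y w"
    using assms unfolding refine_def by blast+
  then have V: "x \<in> V" "y \<in> V" using R_in by blast+
  have tie: "\<not> R z x" "\<not> R y z" "R z w"
    using negtrans[of z x y] negtrans[of y z x] negtrans[of x w z] False xy V assms(2) by blast+
  show ?thesis
  proof (cases "z = x")
    case False
    then have "conn x z w \<or> conn z y w"
      using conn_exchange[OF xy(5) _ assms(2) _ V(1)] by blast
    then show ?thesis using tie xy \<open>\<not> (R x y \<or> R x z \<or> R z y)\<close> unfolding refine_def by blast
  qed (use assms in simp)
qed

text \<open>Refinement can thus be iterated. Among the order conditions, it is \<open>tied\<close>
  whose preservation uses the absence of asteroidal triples.\<close>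

lemma admissible_refine:
  assumes "w \<in> V"
  shows "admissible_order V A (refine w)"
proof
  show "no_wat V A" by (rule no_wat)
next
  fix x y z
  show "refine w x y \<Longrightarrow> x \<in> V" "refine w x y \<Longrightarrow> y \<in> V"
    unfolding refine_def using R_in by blast+
  show "refine w x y \<Longrightarrow> \<not> refine w y x"
    using asym[of x y] tied_before[of x y w] unfolding refine_def by blast
  show "refine w x y \<Longrightarrow> z \<in> V \<Longrightarrow> refine w x z \<or> refine w z y" by (rule refine_negtrans)
  show "\<not> conn y x z" if xy: "refine w x y" and yz: "refine w y z"
  proof (cases "R y z")
    case True
    then show ?thesis using xy split_between[of x y w z] between[of x y z] unfolding refine_def by blast
  next
    case False
    then have yz': "\<not> R z y" "R y w" "R z w" "conn y z w" using yz unfolding refine_def by blast+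
    show ?thesis
    proof
      assume "conn y x z"
      \<comment> \<open>Replacing \<open>z\<close> by the pivot \<open>w\<close> reduces the claim
        to conditions on \<open>R\<close> itself.\<close>
      then have yxw: "conn y x w" using yz'(4) connected_avoiding_trans by metis
      show False
      proof (cases "R x y")
        case True
        then show ?thesis using between[OF True yz'(2)] yxw by blast
      next
        case False
        then show ?thesis using xy yxw tied_before[of x y w] unfolding refine_def by blast
      qed
    qed
  qed
next
  fix x y z
  assume V: "x \<in> V" "y \<in> V" and nxy: "\<not> refine w x y" "\<not> refine w y x"
    and z: "refine w x z \<and> refine w y z \<or> refine w z x \<and> refine w z y"
  have tie: "\<not> R x y" "\<not> R y x" using nxy unfolding refine_def by blast+
  have zV: "z \<in> V" using z R_in unfolding refine_def by blast
  show "\<not> (conn x y z \<and> conn y x z)"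
  proof
    assume c: "conn x y z \<and> conn y x z"
    have "\<not> (R x z \<and> R y z \<or> R z x \<and> R z y)" using tied[OF V tie] c by blast
    then have w: "R x w \<and> R y w \<and> R z w \<and> (conn x z w \<and> conn y z w \<or> conn z x w \<and> conn z y w)"
      using z tie negtrans[of x z y] negtrans[of y z x] negtrans[of z x y] negtrans[of z y x] V
      unfolding refine_def by blast
    \<comment> \<open>As \<open>conn x y z\<close> holds, this excludes \<open>conn x z w\<close>.
      So \<open>z\<close> precedes both \<open>x\<close> and \<open>y\<close> in the refinement, and
      these are joined through \<open>w\<close> around \<open>z\<close>, giving an asteroidal
      triple.\<close>
    then have "\<not> conn x y w" using nxy tie unfolding refine_def by blast
    then have "conn z x w" "conn z y w" using w c connected_avoiding_trans by metis+
    then have "conn z x y" using conn_sym zV connected_avoiding_trans by metis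
    then show False using wat c by blast
  qed
next
  fix x y u v
  assume V: "x \<in> V" "y \<in> V" "u \<in> V" "v \<in> V" and n: "\<not> refine w x y" "\<not> refine w y x"
    "\<not> refine w u v" "\<not> refine w v u" and xu: "refine w x u"
  have tie: "\<not> R x y" "\<not> R y x" "\<not> R u v" "\<not> R v u" using n unfolding refine_def by blast+
  show "conn u x y \<or> conn x u v"
  proof (cases "R x u")
    case True
    then show ?thesis using tied_pairs V tie by blast
  next
    case False
    then have xu': "\<not> R u x" "R x w" "R u w" "conn x u w" using xu unfolding refine_def by blast+
    \<comment> \<open>Since \<open>u\<close> and \<open>v\<close> remain tied, \<open>x\<close> is
      split from both, and \<open>u\<close> and \<open>v\<close> are joined through \<open>w\<close>
      around \<open>x\<close>.\<close>
    have "refine w x v" using refine_negtrans[OF xu V(4)] n(4) by blast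
    moreover have "\<not> R x v" using negtrans[of x v u] V(3) tie False by blast
    ultimately have "conn x v w" unfolding refine_def by blast
    then have "conn x u v"
      using xu'(4) conn_sym[OF _ V(1)] connected_avoiding_trans by metis
    then show ?thesis by blast
  qed
qed

text \<open>The condition \<open>between\<close> forbids whole paths around \<open>y\<close>. The
  Robinson inequality only needs it for a single edge.\<close>

lemma strict_robinson_if_total:
  assumes "\<And>x y. x \<in> V \<Longrightarrow> y \<in> V \<Longrightarrow> x \<noteq> y \<Longrightarrow> R x y \<or> R y x"
  shows "strict_robinson V A R"
proof -
  have "robinson_triple A x y z" if "R x y" "R y z" for x y z
  proof -
    have "x \<noteq> y" "y \<noteq> z" using that asym by blast+
    then show ?thesis
      using robinson_triple_if_not_connected[OF between[OF that]] that R_in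
      by (auto simp: robinson_triple_def)
  qed
  then show ?thesis using assms asym trans unfolding strict_robinson_def by blast
qed

text \<open>An outside point \<open>z\<close> lies on one side of the whole class, so neither of two
  members is connected to \<open>z\<close> around the other. The resulting inequalities are exactly
  tightness. The pair \<open>c\<close>, \<open>d\<close> ensures that the class is not all of
  \<open>V\<close>.\<close>

lemma tie_class_tight_module:
  assumes unrefinable: "\<And>x y w. \<not> R x y \<Longrightarrow> \<not> R y x \<Longrightarrow> R x w \<and> R y w \<or> R w x \<and> R w y \<Longrightarrow> \<not> conn x y w"
    and p: "p \<in> V" "q \<in> V" "p \<noteq> q" "\<not> R p q" "\<not> R q p"
    and c: "R c d"
  shows "tight_module V A {x \<in> V. \<not> R x p \<and> \<not> R p x}"
proof -
  let ?M = "{x \<in> V. \<not> R x p \<and> \<not> R p x}"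
  have "A x z = A y z \<and> A x z \<le> A x y"
    if "x \<in> ?M" "y \<in> ?M" "z \<in> V - ?M" "x \<noteq> y" for x y z
  proof -
    have V: "x \<in> V" "y \<in> V" "z \<in> V" using that by auto
    have tie: "\<not> R x y" "\<not> R y x" using that negtrans p(1) by blast+
    have z: "R x z \<and> R y z \<or> R z x \<and> R z y" using that negtrans[of z p] negtrans[of p z] by blast
    then have "z \<noteq> x" "z \<noteq> y" using asym by blast+
    moreover have "\<not> conn x y z" "\<not> conn y x z" using unrefinable z tie by blast+
    ultimately show ?thesis
      using robinson_triple_if_not_connected[of V A x y z]
        robinson_triple_if_not_connected[of V A y x z] V that(4) A_sym by force
  qed
  moreover have "?M \<noteq> V" using negtrans[OF c p(1)] R_in c by blast
  moreover have "p \<in> ?M" "q \<in> ?M" using p asym by blast+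
  ultimately show ?thesis using p(3) unfolding tight_module_def by blast
qed

end

section \<open>Ordering a matrix without tight modules\<close>

context similarity_matrix
begin

text \<open>Connectedness around \<open>a\<close> gives \<open>tied_pairs\<close> directly. It also
  gives \<open>tied\<close>, since a violation would complete an asteroidal triple containing
  \<open>a\<close>.\<close>

lemma admissible_initial:
  assumes "no_wat V A" "a \<in> V" "\<And>x y. x \<in> V - {a} \<Longrightarrow> y \<in> V - {a} \<Longrightarrow> conn a x y"
  shows "admissible_order V A (\<lambda>x y. x = a \<and> y \<in> V - {a})"
proof
  fix x y z
  assume "x \<in> V" "y \<in> V" "\<not> (x = a \<and> y \<in> V - {a})" "\<not> (y = a \<and> x \<in> V - {a})"
    "(x = a \<and> z \<in> V - {a}) \<and> (y = a \<and> z \<in> V - {a}) \<or> (z = a \<and> x \<in> V - {a}) \<and> (z = a \<and> y \<in> V - {a})"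
  then show "\<not> (conn x y z \<and> conn y x z)"
    using assms conn_sym[of y x z] connected_avoiding_in(3)[of V A x y z] unfolding no_wat_def by blast
next
  fix x y u v
  assume "x \<in> V" "y \<in> V" "\<not> (y = a \<and> x \<in> V - {a})" "\<not> (x = a \<and> y \<in> V - {a})"
    "u \<in> V" "v \<in> V" "\<not> (u = a \<and> v \<in> V - {a})" "\<not> (v = a \<and> u \<in> V - {a})" "x = a \<and> u \<in> V - {a}"
  then show "conn u x y \<or> conn x u v" using assms(3)[of u v] by blast
qed (use assms in auto)

lemma strict_robinson_if_no_tight_module:
  assumes "no_wat V A" "\<not> (\<exists>M. tight_module V A M)"
  shows "\<exists>R. strict_robinson V A R"
proof (cases "\<exists>x\<in>V. \<exists>y\<in>V. x \<noteq> y")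
  case False
  then have "strict_robinson V A (\<lambda>_ _. False)" unfolding strict_robinson_def by blast
  then show ?thesis by blast
next
  case True
  then obtain a where a: "a \<in> V" "\<And>x y. x \<in> V - {a} \<Longrightarrow> y \<in> V - {a} \<Longrightarrow> conn a x y"
    using exists_connected_point[OF assms(2)] by blast
  obtain b where b: "b \<in> V - {a}" using True by blast
  \<comment> \<open>Relations are stored as subsets of the finite \<open>V \<times> V\<close> so
    that one maximal under inclusion exists.\<close>
  define \<S> where "\<S> = {r. r \<subseteq> V \<times> V \<and> admissible_order V A (\<lambda>x y. (x, y) \<in> r)}"
  let ?r0 = "{a} \<times> (V - {a})"
  have r0: "?r0 \<in> \<S>" using admissible_initial[OF assms(1) a] a(1) by (auto simp: \<S>_def)
  have "finite \<S>" unfolding \<S>_def using fin by (auto intro: finite_subset[of _ "Pow (V \<times> V)"])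
  from finite_has_maximal2[OF this r0]
  obtain r where r: "r \<in> \<S>" "?r0 \<subseteq> r" "\<And>s. s \<in> \<S> \<Longrightarrow> r \<subseteq> s \<Longrightarrow> r = s"
    by metis
  define R where "R = (\<lambda>x y. (x, y) \<in> r)"
  interpret R: admissible_order V A R using r(1) by (simp add: R_def \<S>_def)
  interpret C: admissible_order V A "\<lambda>x y. R y x" by (rule R.admissible_converse)
  have max: "R x y"
    if "admissible_order V A S" "S x y" "\<And>u v. R u v \<Longrightarrow> S u v" for S x y
  proof -
    interpret S: admissible_order V A S by fact
    have "{(x, y). S x y} \<in> \<S>" using that(1) S.R_in by (auto simp: \<S>_def)
    moreover have "r \<subseteq> {(x, y). S x y}" using that(3) by (auto simp: R_def)
    ultimately show "R x y" using r(3) that(2) by (force simp: R_def)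
  qed
  have unrefinable: "\<not> conn x y w"
    if "\<not> R x y" "\<not> R y x" "R x w \<and> R y w \<or> R w x \<and> R w y" for x y w
    using that(3)
  proof
    assume w: "R x w \<and> R y w"
    then have "w \<in> V" using R.R_in by blast
    then have "admissible_order V A (R.refine w)" by (rule R.admissible_refine)
    then have "R x y" if "R.refine w x y"
      using that by (rule max) (simp add: R.refine_def)
    then show ?thesis using \<open>\<not> R x y\<close> \<open>\<not> R y x\<close> w unfolding R.refine_def by blast
  next
    assume w: "R w x \<and> R w y"
    then have "w \<in> V" using R.R_in by blast
    \<comment> \<open>The dual split: refine the converse order, then reverse the result.\<close>
    then have "admissible_order V A (\<lambda>u v. C.refine w v u)"
      by (rule admissible_order.admissible_converse[OF C.admissible_refine])
    then have "R y x" if "C.refine w x y"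
      using that by (rule max[where S = "\<lambda>u v. C.refine w v u"]) (simp add: C.refine_def)
    then show ?thesis using \<open>\<not> R x y\<close> \<open>\<not> R y x\<close> w unfolding C.refine_def by blast
  qed
  have "R a b" using r(2) b by (auto simp: R_def)
  then have "R x y \<or> R y x" if "x \<in> V" "y \<in> V" "x \<noteq> y" for x y
    using R.tie_class_tight_module[of x y a b] unrefinable that assms(2) by blast
  then show ?thesis using R.strict_robinson_if_total by blast
qed

section \<open>Contracting a tight module\<close>

text \<open>The point \<open>m\<close> of the contracted order is blown up to the ordered interval
  \<open>M\<close>. Homogeneity makes \<open>m\<close> a faithful representative, and tightness
  handles triples with just two consecutive points in \<open>M\<close>.\<close>

lemma strict_robinson_substitute:
  assumes M: "tight_module V A M" "m \<in> M"
    and R1: "strict_robinson (insert m (V - M)) A R1"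
    and R2: "strict_robinson M A R2"
  shows "\<exists>R. strict_robinson V A R"
proof -
  define h where "h v = (if v \<in> M then m else v)" for v
  define R where "R x y \<longleftrightarrow> R1 (h x) (h y) \<or> x \<in> M \<and> y \<in> M \<and> R2 x y" for x y
  let ?W = "insert m (V - M)"
  have h: "h x \<in> ?W" if "x \<in> V" for x using that by (auto simp: h_def)
  have MV: "M \<subset> V" and mod: "\<And>x y z. x \<in> M \<Longrightarrow> y \<in> M \<Longrightarrow> z \<in> V - M \<Longrightarrow> A x z = A y z"
    "\<And>x y z. x \<in> M \<Longrightarrow> y \<in> M \<Longrightarrow> z \<in> V - M \<Longrightarrow> x \<noteq> y \<Longrightarrow> A x z \<le> A x y"
    using M(1) unfolding tight_module_def by metis+
  have r1: "\<And>x. x \<in> ?W \<Longrightarrow> \<not> R1 x x"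
    "\<And>x y z. x \<in> ?W \<Longrightarrow> y \<in> ?W \<Longrightarrow> z \<in> ?W \<Longrightarrow> R1 x y \<Longrightarrow> R1 y z \<Longrightarrow> R1 x z"
    "\<And>x y. x \<in> ?W \<Longrightarrow> y \<in> ?W \<Longrightarrow> x \<noteq> y \<Longrightarrow> R1 x y \<or> R1 y x"
    "\<And>x y z. x \<in> ?W \<Longrightarrow> y \<in> ?W \<Longrightarrow> z \<in> ?W \<Longrightarrow> R1 x y \<Longrightarrow> R1 y z \<Longrightarrow> robinson_triple A x y z"
    using R1 unfolding strict_robinson_def by blast+
  have r2: "\<And>x. x \<in> M \<Longrightarrow> \<not> R2 x x"
    "\<And>x y z. x \<in> M \<Longrightarrow> y \<in> M \<Longrightarrow> z \<in> M \<Longrightarrow> R2 x y \<Longrightarrow> R2 y z \<Longrightarrow> R2 x z"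
    "\<And>x y. x \<in> M \<Longrightarrow> y \<in> M \<Longrightarrow> x \<noteq> y \<Longrightarrow> R2 x y \<or> R2 y x"
    "\<And>x y z. x \<in> M \<Longrightarrow> y \<in> M \<Longrightarrow> z \<in> M \<Longrightarrow> R2 x y \<Longrightarrow> R2 y z \<Longrightarrow> robinson_triple A x y z"
    using R2 unfolding strict_robinson_def by blast+
  have hM: "h x = m" if "x \<in> M" for x using that by (simp add: h_def)
  have irrefl: "\<not> R x x" if "x \<in> V" for x using that h r1(1) r2(1) unfolding R_def by blast
  have trans: "R x z" if V: "x \<in> V" "y \<in> V" "z \<in> V" and xy: "R x y" and yz: "R y z" for x y z
    using xy yz r1(2)[OF h[OF V(1)] h[OF V(2)] h[OF V(3)]] r2(2)[of x y z] hM
    unfolding R_def by metis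
  have total: "R x y \<or> R y x" if V: "x \<in> V" "y \<in> V" "x \<noteq> y" for x y
  proof (cases "h x = h y")
    case True
    then have "x \<in> M" "y \<in> M" using V(3) M(2) by (auto simp: h_def split: if_splits)
    then show ?thesis using r2(3) V(3) unfolding R_def by blast
  next
    case False
    then show ?thesis using r1(3) h V unfolding R_def by blast
  qed
  have Ah: "A (h x) (h y) = A x y" if "x \<in> V" "y \<in> V" "h x \<noteq> h y" for x y
  proof -
    have "A m z = A x z" "A z m = A z x" if "x \<in> M" "z \<in> V - M" for x z
    proof -
      have "x \<in> V" "m \<in> V" "z \<in> V" using that M(2) MV by blast+
      then show "A m z = A x z" "A z m = A z x"
        using mod(1)[OF M(2) that] A_sym[of z m] A_sym[of z x] by simp_all
    qed
    then show ?thesis using that by (auto simp: h_def split: if_splits)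
  qed
  have robinson: "robinson_triple A x y z"
    if V: "x \<in> V" "y \<in> V" "z \<in> V" and xy: "R x y" and yz: "R y z" for x y z
  proof (cases "x \<in> M \<and> y \<in> M")
    case xyM: True
    show ?thesis
    proof (cases "z \<in> M")
      case True
      then have "R2 x y" "R2 y z"
        using xy yz xyM r1(1)[of m] hM unfolding R_def by auto
      then show ?thesis using r2(4) xyM True by blast
    next
      case False
      then have "A x z = A y z" "A x z \<le> A x y"
        using mod[of x y z] xyM V xy irrefl by blast+
      then show ?thesis by (simp add: robinson_triple_def)
    qed
  next
    case nxy: False
    then have xy1: "R1 (h x) (h y)" using xy unfolding R_def by blast
    show ?thesis
    proof (cases "y \<in> M \<and> z \<in> M")
      case True
      then have "A y x = A z x" "A z x \<le> A z y"
        using mod(1)[of y z x] mod(2)[of z y x] nxy V yz irrefl by blast+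
      then show ?thesis using A_sym V by (simp add: robinson_triple_def)
    next
      case False
      then have yz1: "R1 (h y) (h z)" using yz unfolding R_def by blast
      \<comment> \<open>This also excludes that \<open>x\<close> and \<open>z\<close> lie in
        \<open>M\<close> with \<open>y\<close> outside, since then \<open>h x = h z\<close>.\<close>
      have "R1 (h x) (h z)" using r1(2) h V xy1 yz1 by blast
      then have "h x \<noteq> h y" "h y \<noteq> h z" "h x \<noteq> h z" using xy1 yz1 r1(1) h V by metis+
      moreover have "robinson_triple A (h x) (h y) (h z)" using r1(4) h V xy1 yz1 by blast
      ultimately show ?thesis using Ah V by (simp add: robinson_triple_def)
    qed
  qed
  have "strict_robinson V A R"
    unfolding strict_robinson_def
    by (intro conjI ballI impI) (metis irrefl trans total robinson)+
  then show ?thesis by blast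
qed

end

section \<open>Induction over proper subsets\<close>

lemma no_wat_imp_strict_robinson:
  assumes "finite V" "symmetric_matrix_on V A" "no_wat V A"
  shows "\<exists>R. strict_robinson V A R"
  using assms
proof (induction V rule: finite_psubset_induct)
  case (psubset V)
  interpret similarity_matrix V A by standard (use psubset in auto)
  have sub: "\<exists>R. strict_robinson W A R" if "W \<subset> V" for W
  proof (rule psubset.IH[OF that])
    show "symmetric_matrix_on W A"
      using psubset.prems(1) that unfolding symmetric_matrix_on_def by blast
    show "no_wat W A" using psubset.prems(2) that by (intro no_wat_subset[of V A W]) auto
  qed
  show ?case
  proof (cases "\<exists>M. tight_module V A M")
    case True
    then obtain M x y where M: "tight_module V A M" "x \<in> M" "y \<in> M" "x \<noteq> y" "M \<subset> V"
      unfolding tight_module_def by blast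
    \<comment> \<open>The contraction is realised inside \<open>V\<close> by the representative
      \<open>x\<close>. It is smaller because \<open>y\<close> is dropped, so the induction
      hypothesis applies to it as well as to \<open>M\<close>.\<close>
    then have "insert x (V - M) \<subseteq> V" "y \<in> V" "y \<notin> insert x (V - M)" by auto
    then have "insert x (V - M) \<subset> V" by blast
    then show ?thesis using strict_robinson_substitute[OF M(1,2)] sub[OF M(5)] sub by metis
  next
    case False
    then show ?thesis using strict_robinson_if_no_tight_module[OF psubset.prems(2)] by simp
  qed
qed

theorem theorem1p2:
  fixes V :: "'a set" and A :: "'a \<Rightarrow> 'a \<Rightarrow> real"
  assumes "finite V"
    and "symmetric_matrix_on V A"
  shows "robinsonian_similarity V A \<longleftrightarrow> \<not> (\<exists>T. weighted_asteroidal_triple V A T)"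
proof -
  interpret similarity_matrix V A by standard (use assms in auto)
  show ?thesis
    using robinsonian_imp_no_wat no_wat_imp_strict_robinson[OF assms]
      robinsonian_similarity_if_strict_robinson no_wat_iff by metis
qed

end
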